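(* Let $p,n\in\mathbb{N}$, $m_1=m_2=p$, $m=2p$, $j=\mathrm{diag}\{I_p,-I_p\}$, let $c_1\neq c_2$ be real numbers, and let $\beta_1,\beta_2\in\mathbb{C}^{p\times m}$ be constant matrices such that $$\beta_kj\beta_k^*=0\quad(k=1,2),\qquad \beta_1j\beta_2^*=I_p.$$ Let $\{A,S(0),\Pi(0)\}$ be a triple with $A,S(0)\in\mathbb{C}^{n\times n}$, $\Pi(0)\in\mathbb{C}^{n\times m}$, $c_1,c_2\notin\sigma(A)$, $AS(0)-S(0)A^*=\mathrm{i}\Pi(0)j\Pi(0)^*$ and $S(0)=S(0)^*$. Let $Q\in\mathbb{C}^{n\times n}$ be a square root: $$Q^2=(A-c_1I_n)^{-1}(A-c_2I_n)^{-1},$$ and let $h_1,h_2\in\mathbb{C}^{n\times p}$ satisfy $$h_1+h_2=\Pi(0)j\beta_1^*,\qquad (A-c_2I_n)Q(h_2-h_1)=\Pi(0)j\beta_2^*.$$ Then the solution $\Pi(x)$, with the given value $\Pi(0)$ at $x=0$, of the equation $$\Pi'(x)=-\mathrm{i}\sum_{k=1}^{2}(A-c_kI_n)^{-1}\Pi(x)j\beta_k^*\beta_k$$ on an interval $\mathcal I\ni0$ is given explicitly by $$\Pi(x)j\begin{bmatrix}\beta_1^*&\beta_2^*\end{bmatrix}=\begin{bmatrix}\Phi_1(x)&\Phi_2(x)\end{bmatrix},$$ where $\Phi_1(x),\Phi_2(x)\in\mathbb{C}^{n\times p}$ are $$\Phi_1(x)=e^{\mathrm{i}xQ}h_1+e^{-\mathrm{i}xQ}h_2,\qquad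 \Phi_2(x)=-(A-c_2I_n)Q\big(e^{\mathrm{i}xQ}h_1-e^{-\mathrm{i}xQ}h_2\big).$$
   Context: $I_q$ is the $q\times q$ identity matrix, $M^*$ the conjugate transpose, $\sigma(A)$ the spectrum of $A$, $'$ is $d/dx$, and $\mathrm{i}$ is the imaginary unit. No commutation of $Q$ with $A$ is assumed. *)

theory Defs
  imports "HOL-Analysis.Analysis"
begin

text \<open>A matrix in $C^{r \times s}$ has type \<open>complex^'s^'r\<close>. The index set
  of size $m = 2p$ is \<open>'p + 'p\<close>, with \<open>Inl\<close> the first and \<open>Inr\<close> the second
  block of $p$ indices. The notation \<open>mat a\<close> is $a I$.\<close>

definition ctranspose :: "complex^'n^'m \<Rightarrow> complex^'m^'n" where
  "ctranspose M = (\<chi> i k. cnj (M $ k $ i))"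

text \<open>The library's \<open>*s\<close> scales a vector by one of its entries' type,
  so it does not scale a matrix by a complex number.\<close>

definition cscale :: "complex \<Rightarrow> complex^'n^'m \<Rightarrow> complex^'n^'m" where
  "cscale a M = (\<chi> i k. a * M $ i $ k)"

definition spectrum :: "complex^'n^'n \<Rightarrow> complex set" where
  "spectrum A = {z. \<not> invertible (A - mat z)}"

text \<open>The library's \<open>exp\<close> and \<open>^\<close> are not available here, because the product
  \<open>*\<close> on the type of matrices is entrywise.\<close>

definition mpow :: "complex^'n^'n \<Rightarrow> nat \<Rightarrow> complex^'n^'n" where
  "mpow M k = ((\<lambda>N. M ** N) ^^ k) (mat 1)"

definition mexp :: "complex^'n^'n \<Rightarrow> complex^'n^'n" where
  "mexp M = (\<Sum>k. (1 / fact k) *\<^sub>R mpow M k)"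

definition jmat :: "complex^('p::finite + 'p)^('p + 'p)" where
  "jmat = (\<chi> a b. if a = b then (case a of Inl _ \<Rightarrow> 1 | Inr _ \<Rightarrow> -1) else 0)"

definition hblock :: "complex^'p::finite^'r \<Rightarrow> complex^'p^'r \<Rightarrow> complex^('p + 'p)^'r" where
  "hblock M N = (\<chi> i a. case a of Inl k \<Rightarrow> M $ i $ k | Inr k \<Rightarrow> N $ i $ k)"

text \<open>The derivative is taken within \<open>I\<close>, hence one-sided at an endpoint belonging to \<open>I\<close>.\<close>

definition solves_ivp ::
  "complex^'n^'n \<Rightarrow> (nat \<Rightarrow> real) \<Rightarrow> (nat \<Rightarrow> complex^('p::finite + 'p)^'p) \<Rightarrow>
   complex^('p + 'p)^'n \<Rightarrow> real set \<Rightarrow> (real \<Rightarrow> complex^('p + 'p)^'n) \<Rightarrow> bool" where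
  "solves_ivp A c \<beta> P0 I P \<longleftrightarrow>
     P 0 = P0 \<and>
     (\<forall>x\<in>I. (P has_vector_derivative
        cscale (- \<i>) (\<Sum>k = 1..2. matrix_inv (A - mat (of_real (c k))) ** P x ** jmat **
                                   ctranspose (\<beta> k) ** \<beta> k)) (at x within I))"

end

theory Submission
  imports Defs
begin

text \<open>
Write $A_k = A - c_k I_n$. The relations on $\beta_1, \beta_2$ say that the square matrix
with block rows $\beta_2, \beta_1$ is inverse to the one with block columns
$j\beta_1^*, j\beta_2^*$. So a matrix $X$ with $2p$ columns is the same thing as its pair of
coordinates $X_k = X j \beta_k^*$, recovered by $X = X_1\beta_2 + X_2\beta_1$. The differential
equation only involves $\Pi$ through these coordinates, and multiplying it from the right by
$j\beta_1^*$ and $j\beta_2^*$ decouples it from the $\beta_k$: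
\[ \Phi_1' = -\mathrm{i} A_2^{-1}\Phi_2, \qquad \Phi_2' = -\mathrm{i} A_1^{-1}\Phi_1 . \]
The formulas for $\Phi_1, \Phi_2$ solve this system. The first equation is read off from
$\Phi_2 = -A_2 Q(\dots)$. In the second, differentiating produces a second factor $Q$, and
$A_2 Q^2 = A_2 A_1^{-1} A_2^{-1} = A_1^{-1}$ because $A_1$ and $A_2$ commute; $Q$ itself is never moved
past $A$. The conditions on $h_1, h_2$ are the initial conditions in these coordinates.

Two analytic facts carry this: the exponential $e^{axM}$ has derivative $aMe^{axM}$
(\<open>mexp_has_vector_derivative\<close>), and a linear equation on an interval has at most one solution
with a given value at one point (\<open>linear_ode_zero_unique\<close>, applied to the difference of two
solutions).
\<close>

section \<open>Matrix multiplication and scaling\<close>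

lemma cscale_nth [simp]: "cscale a M $ i $ k = a * M $ i $ k"
  by (simp add: cscale_def)

lemma cscale_cscale [simp]: "cscale a (cscale b M) = cscale (a * b) M"
  by (simp add: vec_eq_iff)

lemma cscale_0 [simp]: "cscale 0 M = 0"
  by (simp add: vec_eq_iff)

lemma cscale_minus_left: "cscale (- a) M = - cscale a M"
  by (simp add: vec_eq_iff)

lemma cscale_add_right: "cscale a (M + N) = cscale a M + cscale a N"
  by (simp add: vec_eq_iff algebra_simps)

lemma cscale_diff_right: "cscale a (M - N) = cscale a M - cscale a N"
  by (simp add: vec_eq_iff algebra_simps)

lemma cscale_mult_left: "cscale a M ** N = cscale a (M ** N)"
  by (simp add: vec_eq_iff matrix_matrix_mult_def sum_distrib_left mult_ac)

lemma cscale_mult_right: "M ** cscale a N = cscale a (M ** N)"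
  by (simp add: vec_eq_iff matrix_matrix_mult_def sum_distrib_left mult_ac)

lemma cscale_scaleR: "cscale a (r *\<^sub>R M) = r *\<^sub>R cscale a M"
  by (simp add: vec_eq_iff)

lemma matrix_mult_scaleR_left:
  fixes M :: "complex^'n::finite^'m"
  shows "(r *\<^sub>R M) ** N = r *\<^sub>R (M ** N)"
  by (simp add: vec_eq_iff matrix_matrix_mult_def scaleR_sum_right)

lemma matrix_mult_scaleR_right:
  fixes M :: "complex^'n::finite^'m"
  shows "M ** (r *\<^sub>R N) = r *\<^sub>R (M ** N)"
  by (simp add: vec_eq_iff matrix_matrix_mult_def scaleR_sum_right)

lemma matrix_mult_add_left: "(M + N) ** R = M ** R + N ** R"
  by (simp add: vec_eq_iff matrix_matrix_mult_def sum.distrib distrib_right)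

lemma bounded_bilinear_matrix_mult:
  "bounded_bilinear ((**) :: complex^'n::finite^'m::finite \<Rightarrow> complex^'k::finite^'n \<Rightarrow> complex^'k^'m)"
  by (auto simp: bilinear_conv_bounded_bilinear [symmetric] bilinear_def matrix_add_ldistrib
      matrix_mult_add_left matrix_mult_scaleR_left matrix_mult_scaleR_right intro!: linearI)

lemmas matrix_mult_diff_left = bounded_bilinear.diff_left [OF bounded_bilinear_matrix_mult]
lemmas matrix_mult_diff_right = bounded_bilinear.diff_right [OF bounded_bilinear_matrix_mult]
lemmas matrix_mult_minus_right = bounded_bilinear.minus_right [OF bounded_bilinear_matrix_mult]

lemma mat_eq_cscale: "mat z = cscale z (mat 1)"
  by (simp add: vec_eq_iff mat_def)

lemma mat_mult_left: "mat z ** M = cscale z M"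
  by (subst mat_eq_cscale) (simp add: cscale_mult_left)

lemma mat_mult_right: "M ** mat z = cscale z M"
  by (subst mat_eq_cscale) (simp add: cscale_mult_right)

lemma cscale_mat: "cscale a (mat b) = mat (a * b)"
  by (simp add: vec_eq_iff mat_def)

lemma shifted_matrices_commute:
  fixes M :: "complex^'n::finite^'n"
  shows "(M - mat a) ** (M - mat b) = (M - mat b) ** (M - mat a)"
  by (simp add: matrix_mult_diff_left matrix_mult_diff_right mat_mult_left mat_mult_right
      cscale_mat cscale_diff_right mult.commute)

lemma matrix_inv_inverse:
  assumes "invertible M"
  shows "M ** matrix_inv M = mat 1" "matrix_inv M ** M = mat 1"
  using someI_ex [OF assms [unfolded invertible_def]] by (simp_all add: matrix_inv_def)

section \<open>The matrix exponential\<close>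

lemma mpow_0 [simp]: "mpow M 0 = mat 1"
  by (simp add: mpow_def)

lemma mpow_Suc: "mpow M (Suc k) = M ** mpow M k"
  by (simp add: mpow_def)

lemma mpow_cscale: "mpow (cscale z M) k = cscale (z ^ k) (mpow M k)"
proof (induction k)
  case 0
  show ?case
    by (simp add: vec_eq_iff)
next
  case (Suc k)
  then show ?case
    by (simp add: mpow_Suc cscale_mult_left cscale_mult_right mult.commute)
qed

text \<open>The geometric bound behind the convergence of the exponential series. The norm here is the
  Euclidean norm of the entries, in which the unit matrix generally does not have norm 1; hence the
  factor in front.\<close>

lemma norm_mpow_bound:
  fixes M :: "complex^'n::finite^'n"
  obtains K where "\<And>k. norm (mpow M k) \<le> norm (mat 1 :: complex^'n^'n) * K ^ k"
proof -
  obtain C where C: "C \<ge> 0" "\<And>(X :: complex^'n^'n) (Y :: complex^'n^'n). norm (X ** Y) \<le> norm X * norm Y * C"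
    using bounded_bilinear.nonneg_bounded [OF bounded_bilinear_matrix_mult] by blast
  have "norm (mpow M k) \<le> norm (mat 1 :: complex^'n^'n) * (norm M * C) ^ k" for k
  proof (induction k)
    case (Suc k)
    have "norm (mpow M (Suc k)) \<le> norm M * norm (mpow M k) * C"
      using C(2) [of M "mpow M k"] by (simp add: mpow_Suc)
    also have "\<dots> = (norm M * C) * norm (mpow M k)"
      by simp
    also have "\<dots> \<le> (norm M * C) * (norm (mat 1 :: complex^'n^'n) * (norm M * C) ^ k)"
      by (rule mult_left_mono [OF Suc]) (simp add: C)
    finally show ?case
      by (simp add: mult_ac)
  qed simp
  then show thesis
    using that by blast
qed

lemma summable_mexp: "summable (\<lambda>k. (1 / fact k) *\<^sub>R mpow M k)"
proof -
  obtain K where K: "\<And>k. norm (mpow M k) \<le> norm (mat 1 :: complex^'a^'a) * K ^ k"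
    using norm_mpow_bound by blast
  have "summable (\<lambda>k. norm (mat 1 :: complex^'a^'a) * (K ^ k /\<^sub>R fact k))"
    by (intro summable_mult summable_exp_generic)
  then show ?thesis
  proof (rule summable_comparison_test')
    fix k
    show "norm ((1 / fact k) *\<^sub>R mpow M k) \<le> norm (mat 1 :: complex^'a^'a) * (K ^ k /\<^sub>R fact k)"
      using mult_left_mono [OF K [of k], of "1 / fact k"] by (simp add: field_simps)
  qed
qed

text \<open>Each entry of $e^{zM}$ is an ordinary complex power series in $z$, so that it can be
  differentiated term by term.\<close>

lemma mexp_cscale_nth_sums:
  "(\<lambda>k. (mpow M k $ i $ l / fact k) * z ^ k) sums (mexp (cscale z M) $ i $ l)"
proof -
  have "(\<lambda>k. (1 / fact k) *\<^sub>R mpow (cscale z M) k) sums mexp (cscale z M)"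
    unfolding mexp_def by (rule summable_sums [OF summable_mexp])
  then have "(\<lambda>k. ((1 / fact k) *\<^sub>R mpow (cscale z M) k) $ i $ l) sums (mexp (cscale z M) $ i $ l)"
    by (intro sums_vec_nth)
  then show ?thesis
    unfolding mpow_cscale vector_scaleR_component by (simp add: scaleR_conv_of_real mult_ac)
qed

lemma mexp_0 [simp]: "mexp 0 = mat 1"
proof -
  have "mexp (cscale 0 0) $ i $ l = (mat 1 :: complex^'a^'a) $ i $ l" for i l
    using sums_unique2 [OF mexp_cscale_nth_sums [of 0 i l 0] powser_sums_zero] by simp
  then show ?thesis
    by (simp add: vec_eq_iff)
qed

text \<open>Termwise differentiation shifts the coefficients, which turns $M^k/k!$ into $M M^k/k!$; the
  factor $M$ is a finite combination of the power series of one column.\<close>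

lemma mexp_cscale_nth_has_field_derivative:
  "((\<lambda>z. mexp (cscale z M) $ i $ l) has_field_derivative (M ** mexp (cscale z M)) $ i $ l) (at z)"
proof -
  define c where "c r k = mpow M k $ r $ l / fact k" for r k
  have sums: "(\<lambda>k. c r k * w ^ k) sums (mexp (cscale w M) $ r $ l)" for r w
    unfolding c_def by (rule mexp_cscale_nth_sums)
  have "((\<lambda>z. \<Sum>k. c i k * z ^ k) has_field_derivative (\<Sum>k. diffs (c i) k * z ^ k)) (at z)"
    by (rule termdiffs_strong_converges_everywhere) (rule sums_summable [OF sums])
  moreover have "diffs (c i) k = (\<Sum>r\<in>UNIV. M $ i $ r * c r k)" for k
  proof -
    have "diffs (c i) k = (M ** mpow M k) $ i $ l / fact k"
      by (simp add: diffs_def c_def mpow_Suc [symmetric] field_simps del: of_nat_Suc)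
    then show ?thesis
      by (simp add: c_def matrix_matrix_mult_def sum_divide_distrib)
  qed
  then have "(\<lambda>k. diffs (c i) k * z ^ k) sums (\<Sum>r\<in>UNIV. M $ i $ r * mexp (cscale z M) $ r $ l)"
    using sums_sum [of UNIV "\<lambda>r k. M $ i $ r * (c r k * z ^ k)", OF sums_mult [OF sums]]
    by (simp add: sum_distrib_left mult_ac)
  ultimately show ?thesis
    by (simp add: sums_unique [OF sums, symmetric] sums_iff matrix_matrix_mult_def)
qed

lemma has_vector_derivative_matrixI:
  fixes F :: "real \<Rightarrow> complex^'n::finite^'m::finite"
  assumes "\<And>i l. ((\<lambda>x. F x $ i $ l) has_vector_derivative F' $ i $ l) (at x within S)"
  shows "(F has_vector_derivative F') (at x within S)"
  unfolding has_vector_derivative_def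
proof (subst has_derivative_componentwise_within, rule ballI)
  fix b :: "complex^'n^'m"
  assume "b \<in> Basis"
  then obtain i l u where b: "b = axis i (axis l u)"
    by (auto simp: Basis_vec_def)
  have "((\<lambda>x. F x $ i $ l \<bullet> u) has_vector_derivative F' $ i $ l \<bullet> u) (at x within S)"
    by (rule bounded_linear.has_vector_derivative [OF bounded_linear_inner_left assms])
  then show "((\<lambda>x. F x \<bullet> b) has_derivative (\<lambda>h. (h *\<^sub>R F') \<bullet> b)) (at x within S)"
    by (simp add: b inner_axis has_vector_derivative_def)
qed

lemma mexp_has_vector_derivative:
  fixes M :: "complex^'n::finite^'n"
  shows "((\<lambda>x. mexp (cscale (a * of_real x) M)) has_vector_derivative
          cscale a (M ** mexp (cscale (a * of_real x) M))) (at x within S)"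
proof (rule has_vector_derivative_matrixI)
  fix i l
  have "((\<lambda>x. a * complex_of_real x) has_vector_derivative a) (at x within S)"
    by (auto intro!: derivative_eq_intros)
  from field_vector_diff_chain_within [OF this
      has_field_derivative_at_within [OF mexp_cscale_nth_has_field_derivative]]
  show "((\<lambda>x. mexp (cscale (a * of_real x) M) $ i $ l) has_vector_derivative
          cscale a (M ** mexp (cscale (a * of_real x) M)) $ i $ l) (at x within S)"
    by (simp add: o_def)
qed

section \<open>Uniqueness for linear differential equations\<close>

text \<open>Gronwall's argument: $|f|^2$ damped by $e^{-2Kt}$ has nonpositive derivative, starts at
  $0$ and is nonnegative, so it vanishes.\<close>

lemma growth_bound_imp_zero_unit_interval:
  fixes f :: "real \<Rightarrow> 'a::real_inner"
  assumes deriv: "\<And>t. t \<in> {0..1} \<Longrightarrow> (f has_vector_derivative f' t) (at t within {0..1})"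
    and bound: "\<And>t. t \<in> {0..1} \<Longrightarrow> norm (f' t) \<le> K * norm (f t)"
    and "f 0 = 0"
  shows "f 1 = 0"
proof -
  define u where "u t = exp (- 2 * K * t) * (f t \<bullet> f t)" for t
  define u' where "u' t = 2 * exp (- 2 * K * t) * (f t \<bullet> f' t - K * (f t \<bullet> f t))" for t
  have "(u has_derivative (\<lambda>h. h * u' t)) (at t within {0..1})" if "0 \<le> t" "t \<le> 1" for t
    unfolding u_def u'_def
    using deriv [of t] that
    by (auto intro!: derivative_eq_intros simp: has_vector_derivative_def inner_commute algebra_simps)
  then obtain t where t: "t \<in> {0..1}" "u 1 - u 0 = u' t"
    using mvt_very_simple [of 0 1 u "\<lambda>t h. h * u' t"] by auto
  have "f t \<bullet> f' t \<le> norm (f t) * norm (f' t)"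
    by (rule norm_cauchy_schwarz)
  also have "\<dots> \<le> norm (f t) * (K * norm (f t))"
    by (rule mult_left_mono [OF bound [OF t(1)]]) simp
  also have "\<dots> = K * (f t \<bullet> f t)"
    by (simp add: dot_square_norm power2_eq_square)
  finally have "u' t \<le> 0"
    by (simp add: u'_def mult_le_0_iff)
  then have "u 1 \<le> 0"
    using t assms(3) by (simp add: u_def)
  then have "f 1 \<bullet> f 1 \<le> 0"
    by (simp add: u_def mult_le_0_iff)
  then show ?thesis
    by (metis inner_eq_zero_iff inner_ge_zero order_antisym)
qed

text \<open>Moving along the segment from $a$ to $x$, parametrized by $[0,1]$, treats points on both
  sides of $a$ alike, and reduces the claim to growth in the forward direction.\<close>

lemma linear_ode_zero_unique:
  fixes D :: "real \<Rightarrow> 'a::real_inner"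
  assumes I: "is_interval I" "a \<in> I" "x \<in> I"
    and L: "bounded_linear L"
    and deriv: "\<And>t. t \<in> I \<Longrightarrow> (D has_vector_derivative L (D t)) (at t within I)"
    and "D a = 0"
  shows "D x = 0"
proof -
  define g where "g t = a + t * (x - a)" for t
  obtain K where K: "\<And>v. norm (L v) \<le> norm v * K"
    using bounded_linear.bounded [OF L] by blast
  have gI: "g t \<in> I" if "t \<in> {0..1}" for t
    using convexD_alt [OF is_interval_convex [OF I(1)] I(2,3), of t] that
    by (simp add: g_def algebra_simps)
  have "(D \<circ> g) 1 = 0"
  proof (rule growth_bound_imp_zero_unit_interval)
    fix t :: real
    assume t: "t \<in> {0..1}"
    have "(g has_vector_derivative (x - a)) (at t within {0..1})"
      unfolding g_def by (auto intro!: derivative_eq_intros)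
    moreover have "(D has_vector_derivative L (D (g t))) (at (g t) within g ` {0..1})"
      using has_vector_derivative_within_subset [OF deriv [OF gI [OF t]]] gI by blast
    ultimately show "(D \<circ> g has_vector_derivative (x - a) *\<^sub>R L (D (g t))) (at t within {0..1})"
      by (rule vector_diff_chain_within)
    show "norm ((x - a) *\<^sub>R L (D (g t))) \<le> (\<bar>x - a\<bar> * K) * norm ((D \<circ> g) t)"
      using mult_left_mono [OF K [of "D (g t)"], of "\<bar>x - a\<bar>"] by (simp add: mult_ac)
  qed (simp add: g_def assms)
  then show ?thesis
    by (simp add: g_def)
qed

section \<open>Conjugate transposes and block matrices\<close>

lemma ctranspose_ctranspose [simp]: "ctranspose (ctranspose M) = M"
  by (simp add: ctranspose_def vec_eq_iff)

lemma ctranspose_mult: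
  "ctranspose (M ** N) = ctranspose N ** ctranspose M"
  by (simp add: ctranspose_def vec_eq_iff matrix_matrix_mult_def mult_ac)

lemma ctranspose_mat_1 [simp]: "ctranspose (mat 1) = mat 1"
  by (auto simp: ctranspose_def vec_eq_iff mat_def)

lemma ctranspose_jmat [simp]: "ctranspose jmat = jmat"
  by (auto simp: ctranspose_def vec_eq_iff jmat_def split: sum.splits)

definition vblock :: "complex^'m^'p::finite \<Rightarrow> complex^'m^'p \<Rightarrow> complex^'m^('p + 'p)" where
  "vblock X Y = (\<chi> a. case a of Inl k \<Rightarrow> X $ k | Inr k \<Rightarrow> Y $ k)"

lemma sum_UNIV_sum_type:
  "(\<Sum>a\<in>UNIV. g a) = (\<Sum>k\<in>UNIV. g (Inl k)) + (\<Sum>k\<in>UNIV. g (Inr k))"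
  for g :: "'a::finite + 'b::finite \<Rightarrow> 'c::comm_monoid_add"
  using sum.Plus [of "UNIV :: 'a set" "UNIV :: 'b set" g] by (simp add: o_def)

lemma hblock_mult_vblock:
  "hblock M N ** vblock X Y = M ** X + N ** Y"
  by (simp add: vec_eq_iff matrix_matrix_mult_def hblock_def vblock_def sum_UNIV_sum_type)

lemma mult_hblock: "P ** hblock M N = hblock (P ** M) (P ** N)"
  by (auto simp: vec_eq_iff matrix_matrix_mult_def hblock_def split: sum.splits)

lemma vblock_mult_hblock_eq_mat_1:
  assumes "X ** M = mat 1" "X ** N = 0" "Y ** M = 0" "Y ** N = mat 1"
  shows "vblock X Y ** hblock M N = mat 1"
proof -
  have "(vblock X Y ** hblock M N) $ a $ b = mat 1 $ a $ b" for a b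
    using assms
    by (auto simp: vec_eq_iff matrix_matrix_mult_def hblock_def vblock_def mat_def split: sum.splits)
  then show ?thesis
    by (simp add: vec_eq_iff)
qed

theorem proposition3p5:
  fixes c :: "nat \<Rightarrow> real"
    and \<beta> :: "nat \<Rightarrow> complex^('p::finite + 'p)^'p"
    and A S0 Q :: "complex^'n::finite^'n"
    and P0 :: "complex^('p + 'p)^'n"
    and h1 h2 :: "complex^'p^'n"
    and I :: "real set"
    and \<Phi>1 \<Phi>2 :: "real \<Rightarrow> complex^'p^'n"
  assumes "c 1 \<noteq> c 2"
    and "\<beta> 1 ** jmat ** ctranspose (\<beta> 1) = 0"
    and "\<beta> 2 ** jmat ** ctranspose (\<beta> 2) = 0"
    and "\<beta> 1 ** jmat ** ctranspose (\<beta> 2) = mat 1"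
    and "of_real (c 1) \<notin> spectrum A"
    and "of_real (c 2) \<notin> spectrum A"
    and "A ** S0 - S0 ** ctranspose A = cscale \<i> (P0 ** jmat ** ctranspose P0)"
    and "S0 = ctranspose S0"
    and "Q ** Q = matrix_inv (A - mat (of_real (c 1))) ** matrix_inv (A - mat (of_real (c 2)))"
    and "h1 + h2 = P0 ** jmat ** ctranspose (\<beta> 1)"
    and "(A - mat (of_real (c 2))) ** Q ** (h2 - h1) = P0 ** jmat ** ctranspose (\<beta> 2)"
    and "is_interval I" and "0 \<in> I"
    and "\<And>x. \<Phi>1 x = mexp (cscale (\<i> * of_real x) Q) ** h1 + mexp (cscale (- \<i> * of_real x) Q) ** h2"
    and "\<And>x. \<Phi>2 x = - ((A - mat (of_real (c 2))) ** Q **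
            (mexp (cscale (\<i> * of_real x) Q) ** h1 - mexp (cscale (- \<i> * of_real x) Q) ** h2))"
  shows "\<exists>P. solves_ivp A c \<beta> P0 I P \<and>
             (\<forall>P'. solves_ivp A c \<beta> P0 I P' \<longrightarrow> (\<forall>x\<in>I. P' x = P x)) \<and>
             (\<forall>x\<in>I. P x ** jmat ** hblock (ctranspose (\<beta> 1)) (ctranspose (\<beta> 2)) = hblock (\<Phi>1 x) (\<Phi>2 x))"
proof -
  define B1 B2 where "B1 = \<beta> 1" and "B2 = \<beta> 2"
  define A1 A2 where "A1 = A - mat (of_real (c 1))" and "A2 = A - mat (of_real (c 2))"
  define R1 R2 where "R1 = matrix_inv A1" and "R2 = matrix_inv A2"
  define Ep Em where "Ep x = mexp (cscale (\<i> * of_real x) Q)"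
    and "Em x = mexp (cscale (- \<i> * of_real x) Q)" for x :: real
  define P where "P x = \<Phi>1 x ** B2 + \<Phi>2 x ** B1" for x
  define G where "G X = cscale (- \<i>) (R1 ** X ** jmat ** ctranspose B1 ** B1 +
                                      R2 ** X ** jmat ** ctranspose B2 ** B2)" for X

  have Phi1: "\<Phi>1 x = Ep x ** h1 + Em x ** h2" for x
    by (simp add: assms Ep_def Em_def)
  have Phi2: "\<Phi>2 x = - (A2 ** Q ** (Ep x ** h1 - Em x ** h2))" for x
    by (simp add: assms Ep_def Em_def A2_def)

  have gram: "B1 ** jmat ** ctranspose B1 = 0" "B2 ** jmat ** ctranspose B2 = 0"
    "B1 ** jmat ** ctranspose B2 = mat 1"
    using assms by (simp_all add: B1_def B2_def)
  have gram21: "B2 ** jmat ** ctranspose B1 = mat 1"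
    using arg_cong [OF gram(3), of ctranspose] by (simp add: ctranspose_mult matrix_mul_assoc)
  \<comment> \<open>The Gram relations give one product of the two square block matrices; finite size gives the other.\<close>
  have left_inv: "vblock B2 B1 ** (jmat ** hblock (ctranspose B1) (ctranspose B2)) = mat 1"
    unfolding mult_hblock [of jmat]
    by (rule vblock_mult_hblock_eq_mat_1) (simp_all add: gram gram21 matrix_mul_assoc)
  then have right_inv: "(jmat ** hblock (ctranspose B1) (ctranspose B2)) ** vblock B2 B1 = mat 1"
    by (simp only: matrix_left_right_inverse)
  have P_coord: "P x ** jmat ** ctranspose B1 = \<Phi>1 x" "P x ** jmat ** ctranspose B2 = \<Phi>2 x" for x
    by (simp_all add: P_def matrix_mult_add_left matrix_mul_assoc [symmetric] gram [unfolded matrix_mul_assoc [symmetric]]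
      gram21 [unfolded matrix_mul_assoc [symmetric]])

  have inv: "A1 ** R1 = mat 1" "R1 ** A1 = mat 1" "A2 ** R2 = mat 1" "R2 ** A2 = mat 1"
    using assms(5,6) by (simp_all add: spectrum_def A1_def A2_def R1_def R2_def matrix_inv_inverse)
  have A12: "A1 ** A2 = A2 ** A1"
    unfolding A1_def A2_def by (rule shifted_matrices_commute)
  \<comment> \<open>Commuting with \<open>A1\<close> passes to the inverse of \<open>A1\<close>.\<close>
  have "A2 ** R1 = (R1 ** A1) ** (A2 ** R1)"
    by (simp add: inv)
  also have "\<dots> = R1 ** (A1 ** A2) ** R1"
    by (simp only: matrix_mul_assoc)
  also have "\<dots> = R1 ** A2 ** (A1 ** R1)"
    by (simp only: A12 matrix_mul_assoc)
  finally have comm: "A2 ** R1 = R1 ** A2"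
    by (simp add: inv)
  have "A2 ** Q ** Q = A2 ** R1 ** R2"
    using assms(9) by (simp add: A1_def A2_def R1_def R2_def matrix_mul_assoc [symmetric])
  also have "\<dots> = R1 ** (A2 ** R2)"
    by (simp only: comm matrix_mul_assoc)
  finally have QQ: "A2 ** Q ** Q = R1"
    by (simp add: inv)

  have dEp: "((\<lambda>x. Ep x ** h1) has_vector_derivative cscale \<i> (Q ** Ep x ** h1)) (at x within S)" for x S
    using bounded_linear.has_vector_derivative
      [OF bounded_bilinear.bounded_linear_left [OF bounded_bilinear_matrix_mult, of h1]
          mexp_has_vector_derivative [of \<i> Q x S]]
    by (simp add: Ep_def cscale_mult_left)
  have dEm: "((\<lambda>x. Em x ** h2) has_vector_derivative cscale (- \<i>) (Q ** Em x ** h2)) (at x within S)" for x S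
    using bounded_linear.has_vector_derivative
      [OF bounded_bilinear.bounded_linear_left [OF bounded_bilinear_matrix_mult, of h2]
          mexp_has_vector_derivative [of "- \<i>" Q x S]]
    by (simp add: Em_def cscale_mult_left)
  have dPhi1: "(\<Phi>1 has_vector_derivative cscale (- \<i>) (R2 ** \<Phi>2 x)) (at x within S)" for x S
  proof -
    have "R2 ** \<Phi>2 x = - ((R2 ** A2) ** (Q ** (Ep x ** h1 - Em x ** h2)))"
      by (simp only: Phi2 matrix_mult_minus_right matrix_mul_assoc)
    also have "\<dots> = - (Q ** Ep x ** h1 - Q ** Em x ** h2)"
      by (simp add: inv matrix_mult_diff_right matrix_mul_assoc)
    finally have "cscale (- \<i>) (R2 ** \<Phi>2 x) = cscale \<i> (Q ** Ep x ** h1) + cscale (- \<i>) (Q ** Em x ** h2)"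
      by (simp only: cscale_minus_left) (simp add: vec_eq_iff right_diff_distrib)
    then show ?thesis
      using has_vector_derivative_add [OF dEp dEm, of x S] by (simp add: Phi1 [abs_def])
  qed
  have dPhi2: "(\<Phi>2 has_vector_derivative cscale (- \<i>) (R1 ** \<Phi>1 x)) (at x within S)" for x S
  proof -
    have "- (A2 ** Q ** (cscale \<i> (Q ** Ep x ** h1) - cscale (- \<i>) (Q ** Em x ** h2)))
        = cscale (- \<i>) (A2 ** Q ** Q ** (Ep x ** h1 + Em x ** h2))"
      by (simp add: cscale_minus_left cscale_mult_right cscale_add_right matrix_add_ldistrib
          matrix_mul_assoc)
    then show ?thesis
      using has_vector_derivative_minus [OF bounded_linear.has_vector_derivative
          [OF bounded_bilinear.bounded_linear_right [OF bounded_bilinear_matrix_mult, of "A2 ** Q"]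
              has_vector_derivative_diff [OF dEp dEm, of x S]]]
      by (simp add: Phi2 [abs_def] QQ Phi1)
  qed
  have dP: "(P has_vector_derivative G (P x)) (at x within S)" for x S
  proof -
    have "G (P x) = cscale (- \<i>) (R2 ** \<Phi>2 x) ** B2 + cscale (- \<i>) (R1 ** \<Phi>1 x) ** B1"
      using P_coord [of x]
      by (simp add: G_def cscale_mult_left cscale_add_right matrix_mul_assoc [symmetric])
    then show ?thesis
      unfolding P_def
      by (simp add: has_vector_derivative_add dPhi1 dPhi2 bounded_linear.has_vector_derivative
          [OF bounded_bilinear.bounded_linear_left [OF bounded_bilinear_matrix_mult]])
  qed

  \<comment> \<open>The conditions on \<open>h1\<close> and \<open>h2\<close> fix the coordinates of \<open>P0\<close>, and \<open>right_inv\<close> says that these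
    determine \<open>P0\<close>.\<close>
  have "P 0 = (h1 + h2) ** B2 + A2 ** Q ** (h2 - h1) ** B1"
    by (simp add: P_def Phi1 Phi2 Ep_def Em_def matrix_mult_minus_right [symmetric])
  also have "\<dots> = P0 ** jmat ** ctranspose B1 ** B2 + P0 ** jmat ** ctranspose B2 ** B1"
    using assms(10,11) by (simp add: A2_def B1_def B2_def)
  also have "\<dots> = P0 ** ((jmat ** hblock (ctranspose B1) (ctranspose B2)) ** vblock B2 B1)"
    by (simp add: mult_hblock hblock_mult_vblock matrix_add_ldistrib matrix_mul_assoc)
  finally have P_0: "P 0 = P0"
    by (simp only: right_inv matrix_mul_rid)

  have solves_iff: "solves_ivp A c \<beta> P0 I X \<longleftrightarrow>
      X 0 = P0 \<and> (\<forall>x\<in>I. (X has_vector_derivative G (X x)) (at x within I))" for X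
  proof -
    have "{1..2::nat} = {1, 2}"
      by auto
    then show ?thesis
      by (simp add: solves_ivp_def G_def A1_def A2_def R1_def R2_def B1_def B2_def)
  qed
  have G_add: "G (X + Y) = G X + G Y" for X Y
    by (simp add: G_def matrix_add_ldistrib matrix_mult_add_left cscale_add_right)
  have G_scaleR: "G (r *\<^sub>R X) = r *\<^sub>R G X" for r X
    by (simp add: G_def matrix_mult_scaleR_left matrix_mult_scaleR_right cscale_scaleR
        scaleR_add_right [symmetric])
  have "linear G"
    by (intro linearI G_add G_scaleR)
  then have G: "bounded_linear G" and G_diff: "G (X - Y) = G X - G Y" for X Y
    by (simp_all add: linear_conv_bounded_linear linear_diff)
  have "X x = P x" if X: "solves_ivp A c \<beta> P0 I X" and "x \<in> I" for X x
  proof -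
    have "X x - P x = 0"
    proof (rule linear_ode_zero_unique [OF \<open>is_interval I\<close> \<open>0 \<in> I\<close> \<open>x \<in> I\<close> G])
      show "((\<lambda>x. X x - P x) has_vector_derivative G (X t - P t)) (at t within I)" if "t \<in> I" for t
        using X that dP by (simp add: solves_iff G_diff has_vector_derivative_diff)
      show "X 0 - P 0 = 0"
        using X by (simp add: solves_iff P_0)
    qed
    then show ?thesis
      by simp
  qed
  moreover have "solves_ivp A c \<beta> P0 I P"
    by (simp add: solves_iff P_0 dP)
  moreover have "P x ** jmat ** hblock (ctranspose (\<beta> 1)) (ctranspose (\<beta> 2)) = hblock (\<Phi>1 x) (\<Phi>2 x)" for x
    using P_coord [of x] by (simp add: mult_hblock B1_def B2_def)
  ultimately show ?thesis
    by blast
qed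

end
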